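(* Let $H$ be a finite group with $|H|\geq 3$, let $\mathcal{G}=\{G_1,\ldots,G_t\}$ ($t\geq 1$) be a finite family of finite groups, and for each integer $k\geq 1$ let $(Q_k,\sigma_k)$ be a separating pair of level $k$ for $(H,\mathcal{G})$ (as defined in the context). Let $\mathcal{W}_{H,\mathcal{G}}$ be the class of all ai-semirings $S$ such that $S\models\sigma_k$ for every $k\geq 1$. If $\mathcal{U}$ is an ai-semiring variety with $\mathsf{V}(\mathcal{P}(H))\subseteq\mathcal{U}\subseteq\mathcal{W}_{H,\mathcal{G}}$, then every ai-semiring variety $\mathcal{V}$ with $\mathcal{U}\subseteq\mathcal{V}\subseteq\mathcal{U}^0$ has infinite axiomatic rank and is nonfinitely based.
   Context: An additively idempotent semiring (ai-semiring) is an algebra $(S,+,\cdot)$ with two binary operations (no constants in the signature) such that $(S,+)$ is a commutative idempotent semigroup, $(S,\cdot)$ is a semigroup, and multiplication distributes over addition on both sides. Every ai-semiring term can be written as a finite nonempty sum of words (elements of the free semigroup over a countably infinite set of variables). The content of a word is the set of variables occurring in it. An ai-semiring inequality $\mathbf{u}\preceq\mathbf{v}$ between terms means the identity $\mathbf{v}\approx\mathbf{v}+\mathbf{u}$. For a semigroup $S$, $\mathcal{P}(S)$ is the ai-semiring of all nonempty subsets of $S$ with $A+B=A\cup B$ and $AB=\{ab:a\in A,\ b\in B\}$; $\mathcal{P}(S)^0$ is the ai-semiring of all subsets of $S$ (including $\varnothing$) with the same operations. For any ai-semiring $S$, $S^0=S\cup\{0\}$ is obtained by adjoining a new element $0$ with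 $a+0=0+a=a$ and $a0=0a=0$ for all $a\in S^0$. $\mathsf{V}(\ldots)$ or $\mathsf{V}\{\ldots\}$ denotes the variety generated by the listed ai-semirings. For an ai-semiring variety $\mathcal{U}$, $\mathcal{U}^0=\mathsf{V}\{S^0:S\in\mathcal{U}\}$. Separating pair of level $k$ for $(H,\mathcal{G})$: a pair $(Q_k,\sigma_k)$ consisting of a finite commutative (i.e. multiplicatively commutative) ai-semiring $Q_k$ and an inequality $\sigma_k$ such that (a) every subsemiring of $Q_k$ generated by at most $k$ elements belongs to $\mathsf{V}(\mathcal{P}(H))$; (b) $Q_k\not\models\sigma_k$; (c) $\mathcal{P}(H)^0,\mathcal{P}(G_1)^0,\ldots,\mathcal{P}(G_t)^0$ all satisfy $\sigma_k$; (d) every word (summand) on either side of $\sigma_k$ has the same content. (Such pairs exist for every $k\geq1$.) A variety is finitely based if its identities admit a finite basis, and nonfinitely based otherwise. A variety has infinite axiomatic rank if, for every positive integer $k$, its identities involving at most $k$ variables do not form a basis for all its identities. *)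

theory Defs
  imports "HOL-Algebra.Coset"
begin

section \<open>Ai-semirings\<close>

text \<open>Algebras with two binary operations; the operations are only relevant on the carrier.\<close>

record 'a bimagma = "'a partial_object" +
  badd :: "['a, 'a] \<Rightarrow> 'a" (infixl "\<boxplus>\<index>" 65)
  bmul :: "['a, 'a] \<Rightarrow> 'a" (infixl "\<boxdot>\<index>" 70)

locale ai_semiring =
  fixes S (structure)
  assumes nonempty: "carrier S \<noteq> {}"
    and add_closed: "\<lbrakk>a \<in> carrier S; b \<in> carrier S\<rbrakk> \<Longrightarrow> a \<boxplus> b \<in> carrier S"
    and mul_closed: "\<lbrakk>a \<in> carrier S; b \<in> carrier S\<rbrakk> \<Longrightarrow> a \<boxdot> b \<in> carrier S"
    and add_assoc: "\<lbrakk>a \<in> carrier S; b \<in> carrier S; c \<in> carrier S\<rbrakk>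
      \<Longrightarrow> (a \<boxplus> b) \<boxplus> c = a \<boxplus> (b \<boxplus> c)"
    and add_comm: "\<lbrakk>a \<in> carrier S; b \<in> carrier S\<rbrakk> \<Longrightarrow> a \<boxplus> b = b \<boxplus> a"
    and add_idem: "a \<in> carrier S \<Longrightarrow> a \<boxplus> a = a"
    and mul_assoc: "\<lbrakk>a \<in> carrier S; b \<in> carrier S; c \<in> carrier S\<rbrakk>
      \<Longrightarrow> (a \<boxdot> b) \<boxdot> c = a \<boxdot> (b \<boxdot> c)"
    and distrib_left: "\<lbrakk>a \<in> carrier S; b \<in> carrier S; c \<in> carrier S\<rbrakk>
      \<Longrightarrow> a \<boxdot> (b \<boxplus> c) = (a \<boxdot> b) \<boxplus> (a \<boxdot> c)"
    and distrib_right: "\<lbrakk>a \<in> carrier S; b \<in> carrier S; c \<in> carrier S\<rbrakk>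
      \<Longrightarrow> (a \<boxplus> b) \<boxdot> c = (a \<boxdot> c) \<boxplus> (b \<boxdot> c)"

definition mult_commutative :: "'a bimagma \<Rightarrow> bool" where
  "mult_commutative S \<longleftrightarrow>
     (\<forall>a\<in>carrier S. \<forall>b\<in>carrier S. a \<boxdot>\<^bsub>S\<^esub> b = b \<boxdot>\<^bsub>S\<^esub> a)"

definition power_semiring :: "'a monoid \<Rightarrow> 'a set bimagma" where
  "power_semiring G =
     \<lparr>carrier = Pow (carrier G) - {{}}, badd = (\<union>), bmul = (\<lambda>A B. A <#>\<^bsub>G\<^esub> B)\<rparr>"

definition power_semiring0 :: "'a monoid \<Rightarrow> 'a set bimagma" where
  "power_semiring0 G =
     \<lparr>carrier = Pow (carrier G), badd = (\<union>), bmul = (\<lambda>A B. A <#>\<^bsub>G\<^esub> B)\<rparr>"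

text \<open>\<open>S\<close> with a new element \<open>0\<close>, represented by \<open>None\<close>.\<close>

definition adjoin_zero :: "'a bimagma \<Rightarrow> 'a option bimagma" where
  "adjoin_zero S =
     \<lparr>carrier = insert None (Some ` carrier S),
      badd = (\<lambda>x y. case x of None \<Rightarrow> y
               | Some a \<Rightarrow> (case y of None \<Rightarrow> Some a | Some b \<Rightarrow> Some (a \<boxplus>\<^bsub>S\<^esub> b))),
      bmul = (\<lambda>x y. case x of None \<Rightarrow> None
               | Some a \<Rightarrow> (case y of None \<Rightarrow> None | Some b \<Rightarrow> Some (a \<boxdot>\<^bsub>S\<^esub> b)))\<rparr>"


section \<open>Subalgebras, homomorphic images, products, varieties\<close>

definition subsemiring :: "'a set \<Rightarrow> 'a bimagma \<Rightarrow> bool" where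
  "subsemiring B S \<longleftrightarrow> B \<noteq> {} \<and> B \<subseteq> carrier S \<and>
     (\<forall>a\<in>B. \<forall>b\<in>B. a \<boxplus>\<^bsub>S\<^esub> b \<in> B \<and> a \<boxdot>\<^bsub>S\<^esub> b \<in> B)"

text \<open>Used only for nonempty \<open>X\<close>.\<close>

definition generated_subsemiring :: "'a bimagma \<Rightarrow> 'a set \<Rightarrow> 'a bimagma" where
  "generated_subsemiring S X = S\<lparr>carrier := \<Inter>{B. subsemiring B S \<and> X \<subseteq> B}\<rparr>"

definition hom_onto :: "('a \<Rightarrow> 'b) \<Rightarrow> 'a bimagma \<Rightarrow> 'b bimagma \<Rightarrow> bool" where
  "hom_onto h S T \<longleftrightarrow> h ` carrier S = carrier T \<and>
     (\<forall>a\<in>carrier S. \<forall>b\<in>carrier S.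
        h (a \<boxplus>\<^bsub>S\<^esub> b) = h a \<boxplus>\<^bsub>T\<^esub> h b \<and> h (a \<boxdot>\<^bsub>S\<^esub> b) = h a \<boxdot>\<^bsub>T\<^esub> h b)"

definition direct_product :: "'i set \<Rightarrow> ('i \<Rightarrow> 'a bimagma) \<Rightarrow> ('i \<Rightarrow> 'a) bimagma" where
  "direct_product I A =
     \<lparr>carrier = (\<Pi>\<^sub>E i\<in>I. carrier (A i)),
      badd = (\<lambda>f g. \<lambda>i\<in>I. f i \<boxplus>\<^bsub>A i\<^esub> g i),
      bmul = (\<lambda>f g. \<lambda>i\<in>I. f i \<boxdot>\<^bsub>A i\<^esub> g i)\<rparr>"

text \<open>
  The variety generated by \<open>K\<close>: all homomorphic images of subalgebras of direct products of
  members of \<open>K\<close> (Tarski's \<open>V = HSP\<close>). Classes of algebras are relative to a type from which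
  the carriers are drawn; the type \<open>'b\<close> of the members may differ from the type \<open>'a\<close> of the
  generators.

  Restricting the index sets to the type \<open>nat \<times> 'b\<close> loses nothing. The members with carrier in
  \<open>'b\<close> are images of the relatively free algebra over \<open>'b\<close>, which embeds into a product with one
  factor for each pair of terms over \<open>'b\<close> that some member of \<open>K\<close> separates, and the set of such
  pairs has at most the cardinality of \<open>nat \<times> 'b\<close>.
\<close>

definition variety_gen :: "'a bimagma set \<Rightarrow> 'b bimagma set" where
  "variety_gen K = {S. \<exists>(I :: (nat \<times> 'b) set) A B h.
     (\<forall>i\<in>I. A i \<in> K) \<and> subsemiring B (direct_product I A) \<and>
     hom_onto h ((direct_product I A)\<lparr>carrier := B\<rparr>) S}"

text \<open>
  Closure under homomorphic images, subalgebras and products is required in the combined form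
  \<open>HSP V \<subseteq> V\<close>, since the products themselves need not have a copy with carrier in \<open>'a\<close>.
\<close>

definition ai_variety :: "'a bimagma set \<Rightarrow> bool" where
  "ai_variety V \<longleftrightarrow> (\<forall>S\<in>V. ai_semiring S) \<and> variety_gen V \<subseteq> V"

definition variety_zero :: "'a bimagma set \<Rightarrow> 'a bimagma set" where
  "variety_zero U = variety_gen (adjoin_zero ` U)"


section \<open>Terms, identities and bases\<close>

datatype trm = Var nat | Add trm trm | Mul trm trm

type_synonym identity = "trm \<times> trm"

primrec vars :: "trm \<Rightarrow> nat set" where
  "vars (Var x) = {x}"
| "vars (Add s t) = vars s \<union> vars t"
| "vars (Mul s t) = vars s \<union> vars t"

text \<open>The summands of a term after expanding it into a sum of words.\<close>

primrec words :: "trm \<Rightarrow> nat list set" where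
  "words (Var x) = {[x]}"
| "words (Add s t) = words s \<union> words t"
| "words (Mul s t) = {v @ w | v w. v \<in> words s \<and> w \<in> words t}"

primrec eval_trm :: "'a bimagma \<Rightarrow> (nat \<Rightarrow> 'a) \<Rightarrow> trm \<Rightarrow> 'a" where
  "eval_trm S f (Var x) = f x"
| "eval_trm S f (Add s t) = eval_trm S f s \<boxplus>\<^bsub>S\<^esub> eval_trm S f t"
| "eval_trm S f (Mul s t) = eval_trm S f s \<boxdot>\<^bsub>S\<^esub> eval_trm S f t"

primrec subst :: "(nat \<Rightarrow> trm) \<Rightarrow> trm \<Rightarrow> trm" where
  "subst \<theta> (Var x) = \<theta> x"
| "subst \<theta> (Add s t) = Add (subst \<theta> s) (subst \<theta> t)"
| "subst \<theta> (Mul s t) = Mul (subst \<theta> s) (subst \<theta> t)"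

definition satisfies :: "'a bimagma \<Rightarrow> identity \<Rightarrow> bool" where
  "satisfies S e \<longleftrightarrow>
     (\<forall>f. range f \<subseteq> carrier S \<longrightarrow> eval_trm S f (fst e) = eval_trm S f (snd e))"

text \<open>The pair \<open>(u, v)\<close> read as the inequality \<open>u \<preceq> v\<close>, that is, as the identity \<open>v \<approx> v + u\<close>.\<close>

definition satisfies_ineq :: "'a bimagma \<Rightarrow> trm \<times> trm \<Rightarrow> bool" where
  "satisfies_ineq S p \<longleftrightarrow> satisfies S (snd p, Add (snd p) (fst p))"

definition identities :: "'a bimagma set \<Rightarrow> identity set" where
  "identities V = {e. \<forall>S\<in>V. satisfies S e}"

definition identity_vars :: "identity \<Rightarrow> nat set" where
  "identity_vars e = vars (fst e) \<union> vars (snd e)"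

inductive derives :: "identity set \<Rightarrow> trm \<Rightarrow> trm \<Rightarrow> bool" for E where
  axiom: "(s, t) \<in> E \<Longrightarrow> derives E (subst \<theta> s) (subst \<theta> t)"
| refl: "derives E s s"
| sym: "derives E s t \<Longrightarrow> derives E t s"
| trans: "derives E s t \<Longrightarrow> derives E t u \<Longrightarrow> derives E s u"
| add: "derives E s s' \<Longrightarrow> derives E t t' \<Longrightarrow> derives E (Add s t) (Add s' t')"
| mul: "derives E s s' \<Longrightarrow> derives E t t' \<Longrightarrow> derives E (Mul s t) (Mul s' t')"

definition ai_axioms :: "identity set" where
  "ai_axioms = (let x = Var 0; y = Var 1; z = Var 2 in
     {(Add (Add x y) z, Add x (Add y z)),
      (Add x y, Add y x),
      (Add x x, x),
      (Mul (Mul x y) z, Mul x (Mul y z)),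
      (Mul x (Add y z), Add (Mul x y) (Mul x z)),
      (Mul (Add x y) z, Add (Mul x z) (Mul y z))})"

text \<open>
  Bases are taken relative to the ai-semiring axioms. As these are six identities in three
  variables, the two notions below are the same as without them: adding them to a basis keeps
  it finite, and they are among the identities in at most \<open>k\<close> variables as soon as \<open>k \<ge> 3\<close>.
\<close>

definition basis_of :: "identity set \<Rightarrow> 'a bimagma set \<Rightarrow> bool" where
  "basis_of E V \<longleftrightarrow> E \<subseteq> identities V \<and>
     (\<forall>(s, t)\<in>identities V. derives (ai_axioms \<union> E) s t)"

definition finitely_based :: "'a bimagma set \<Rightarrow> bool" where
  "finitely_based V \<longleftrightarrow> (\<exists>E. finite E \<and> basis_of E V)"

definition infinite_axiomatic_rank :: "'a bimagma set \<Rightarrow> bool" where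
  "infinite_axiomatic_rank V \<longleftrightarrow>
     (\<forall>k\<ge>1. \<not> basis_of {e \<in> identities V. card (identity_vars e) \<le> k} V)"


section \<open>Separating pairs\<close>

text \<open>
  The family of groups is \<open>G 1, \<dots>, G t\<close>. Generating sets are nonempty because the signature has
  no constants and algebras are nonempty.
\<close>

definition separating_pair ::
  "nat \<Rightarrow> 'h monoid \<Rightarrow> nat \<Rightarrow> (nat \<Rightarrow> 'g monoid) \<Rightarrow> 'q bimagma \<Rightarrow> trm \<times> trm \<Rightarrow> bool" where
  "separating_pair k H t G Q \<sigma> \<longleftrightarrow>
     ai_semiring Q \<and> finite (carrier Q) \<and> mult_commutative Q \<and>
     (\<forall>X. X \<noteq> {} \<and> X \<subseteq> carrier Q \<and> card X \<le> k \<longrightarrow>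
        generated_subsemiring Q X \<in> variety_gen {power_semiring H}) \<and>
     \<not> satisfies_ineq Q \<sigma> \<and>
     satisfies_ineq (power_semiring0 H) \<sigma> \<and>
     (\<forall>i\<in>{1..t}. satisfies_ineq (power_semiring0 (G i)) \<sigma>) \<and>
     (\<exists>C. \<forall>w \<in> words (fst \<sigma>) \<union> words (snd \<sigma>). set w = C)"

definition class_W :: "(nat \<Rightarrow> trm \<times> trm) \<Rightarrow> 'a bimagma set" where
  "class_W \<sigma> = {S. ai_semiring S \<and> (\<forall>k\<ge>1. satisfies_ineq S (\<sigma> k))}"

end

theory Submission imports Defs begin

text \<open>
  Since all words of \<open>\<sigma> k\<close> have the same content, an assignment into \<open>S\<^sup>0\<close> either takes its
  values in \<open>S\<close> on the variables of \<open>\<sigma> k\<close> or makes both sides \<open>0\<close>. Hence \<open>\<sigma> k\<close> passes from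
  \<open>U\<close> to \<open>U\<^sup>0\<close>, and so holds in \<open>V\<close>. On the other hand, an identity of \<open>V\<close> in at most \<open>k\<close>
  variables holds in the power semiring of \<open>H\<close>, hence in the subsemirings of \<open>Q k\<close> generated by
  at most \<open>k\<close> elements, hence in \<open>Q k\<close> itself. As \<open>Q k\<close> violates \<open>\<sigma> k\<close>, these identities do not
  imply \<open>\<sigma> k\<close>.
\<close>

section \<open>Terms, their words and their evaluation\<close>

lemma finite_vars: "finite (vars s)"
  by (induction s) auto

lemma vars_nonempty: "vars s \<noteq> {}"
  by (induction s) auto

lemma words_nonempty: "words s \<noteq> {}"
  by (induction s) auto

lemma vars_eq_Union_words: "vars s = \<Union>(set ` words s)"
proof (induction s)
  case (Mul s t)
  \<comment> \<open>A word of one factor survives only inside a concatenation, so the other factor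
    must contribute at least one word.\<close>
  obtain v w where "v \<in> words s" "w \<in> words t"
    using words_nonempty by blast
  with Mul show ?case by fastforce
qed auto

lemma eval_trm_cong: "(\<And>x. x \<in> vars s \<Longrightarrow> f x = g x) \<Longrightarrow> eval_trm S f s = eval_trm S g s"
  by (induction s) auto

lemma eval_trm_carrier_update [simp]: "eval_trm (S\<lparr>carrier := B\<rparr>) f s = eval_trm S f s"
  by (induction s) auto

lemma eval_trm_in_subsemiring:
  "subsemiring B S \<Longrightarrow> range f \<subseteq> B \<Longrightarrow> eval_trm S f s \<in> B"
  by (induction s) (auto simp: subsemiring_def)

lemma eval_trm_subst: "eval_trm S f (subst \<theta> s) = eval_trm S (\<lambda>x. eval_trm S f (\<theta> x)) s"
  by (induction s) auto

text \<open>The condition \<open>subsemiring (carrier S) S\<close> asks only for a nonempty closed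
  carrier. It replaces \<open>ai_semiring\<close> so that subalgebras of products qualify without a
  check of the axioms.\<close>

lemma eval_trm_hom:
  assumes "subsemiring (carrier S) S" "hom_onto h S T" "range f \<subseteq> carrier S"
  shows "eval_trm T (\<lambda>x. h (f x)) s = h (eval_trm S f s)"
  using assms(2) eval_trm_in_subsemiring[OF assms(1,3)]
  by (induction s) (auto simp: hom_onto_def)

lemma subsemiring_carrier: "ai_semiring S \<Longrightarrow> subsemiring (carrier S) S"
  by (auto simp: subsemiring_def ai_semiring_def)

section \<open>Preservation of identities under the operators H, S, P and under derivations\<close>

lemma satisfies_hom_image:
  assumes sub: "subsemiring (carrier S) S" and h: "hom_onto h S T" and e: "satisfies S e"
  shows "satisfies T e"
  unfolding satisfies_def
proof (intro allI impI)
  fix g :: "nat \<Rightarrow> 'b" assume g: "range g \<subseteq> carrier T"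
  \<comment> \<open>Since \<open>h\<close> is onto, an assignment into \<open>T\<close> lifts,
    variable by variable, to one into \<open>S\<close>.\<close>
  have "\<forall>x. \<exists>a\<in>carrier S. h a = g x"
  proof
    fix x
    have "g x \<in> h ` carrier S"
      using g h by (auto simp: hom_onto_def)
    then show "\<exists>a\<in>carrier S. h a = g x" by auto
  qed
  then obtain f where f: "\<And>x. f x \<in> carrier S" "\<And>x. h (f x) = g x"
    by metis
  have "range f \<subseteq> carrier S" using f(1) by auto
  moreover have "g = (\<lambda>x. h (f x))" using f(2) by auto
  ultimately show "eval_trm T g (fst e) = eval_trm T g (snd e)"
    using eval_trm_hom[OF sub h] e by (simp add: satisfies_def)
qed

lemma satisfies_subsemiring:
  "subsemiring B S \<Longrightarrow> satisfies S e \<Longrightarrow> satisfies (S\<lparr>carrier := B\<rparr>) e"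
  by (auto simp: subsemiring_def satisfies_def)

lemma eval_trm_direct_product:
  "i \<in> I \<Longrightarrow> eval_trm (direct_product I A) f s i = eval_trm (A i) (\<lambda>x. f x i) s"
  by (induction s) (auto simp: direct_product_def)

text \<open>Sums and products are restricted to \<open>I\<close> by definition, so only variables
  need the hypothesis. This allows equality in a product to be tested coordinatewise on
  \<open>I\<close>.\<close>

lemma eval_trm_direct_product_extensional:
  "range f \<subseteq> extensional I \<Longrightarrow> eval_trm (direct_product I A) f s \<in> extensional I"
  by (cases s) (auto simp: direct_product_def)

lemma satisfies_direct_product:
  assumes "\<And>i. i \<in> I \<Longrightarrow> satisfies (A i) e"
  shows "satisfies (direct_product I A) e"
  unfolding satisfies_def
proof (intro allI impI)
  fix f :: "nat \<Rightarrow> 'a \<Rightarrow> 'b"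
  assume "range f \<subseteq> carrier (direct_product I A)"
  then have f: "\<And>x. f x \<in> (\<Pi>\<^sub>E i\<in>I. carrier (A i))"
    by (auto simp: direct_product_def)
  have "range f \<subseteq> extensional I"
    using f by (auto simp: PiE_def)
  then show "eval_trm (direct_product I A) f (fst e) = eval_trm (direct_product I A) f (snd e)"
  proof (intro extensionalityI[of _ I] eval_trm_direct_product_extensional)
    fix i assume "i \<in> I"
    then have "range (\<lambda>x. f x i) \<subseteq> carrier (A i)"
      using f by auto
    with assms[OF \<open>i \<in> I\<close>]
    show "eval_trm (direct_product I A) f (fst e) i = eval_trm (direct_product I A) f (snd e) i"
      by (simp add: eval_trm_direct_product[OF \<open>i \<in> I\<close>] satisfies_def)
  qed
qed

lemma satisfies_variety_gen:
  assumes "S \<in> variety_gen K" "\<And>A. A \<in> K \<Longrightarrow> satisfies A e"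
  shows "satisfies S e"
proof -
  obtain I :: "(nat \<times> 'a) set" and A B h where A: "\<forall>i\<in>I. A i \<in> K" and B: "subsemiring B (direct_product I A)"
    and h: "hom_onto h ((direct_product I A)\<lparr>carrier := B\<rparr>) S"
    using assms(1) unfolding variety_gen_def mem_Collect_eq by blast
  have "satisfies ((direct_product I A)\<lparr>carrier := B\<rparr>) e"
    using A B assms(2) by (blast intro: satisfies_subsemiring satisfies_direct_product)
  moreover have "subsemiring B ((direct_product I A)\<lparr>carrier := B\<rparr>)"
    using B by (simp add: subsemiring_def)
  ultimately show ?thesis
    using satisfies_hom_image[OF _ h] by simp
qed

lemma satisfies_derives:
  assumes S: "subsemiring (carrier S) S" and E: "\<And>e. e \<in> E \<Longrightarrow> satisfies S e"
    and "derives E s t"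
  shows "satisfies S (s, t)"
  using assms(3)
proof induction
  case (axiom s t \<theta>)
  show ?case
    unfolding satisfies_def fst_conv snd_conv eval_trm_subst
  proof (intro allI impI)
    fix f :: "nat \<Rightarrow> 'a" assume "range f \<subseteq> carrier S"
    then have "range (\<lambda>x. eval_trm S f (\<theta> x)) \<subseteq> carrier S"
      using eval_trm_in_subsemiring[OF S] by auto
    then show "eval_trm S (\<lambda>x. eval_trm S f (\<theta> x)) s = eval_trm S (\<lambda>x. eval_trm S f (\<theta> x)) t"
      using E[OF axiom] by (simp add: satisfies_def)
  qed
qed (simp_all add: satisfies_def)

lemma satisfies_ai_axioms:
  assumes "ai_semiring S" and "e \<in> ai_axioms"
  shows "satisfies S e"
  unfolding satisfies_def
proof (intro allI impI)
  interpret ai_semiring S by fact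
  fix f :: "nat \<Rightarrow> 'a" assume "range f \<subseteq> carrier S"
  then have "f n \<in> carrier S" for n by auto
  then show "eval_trm S f (fst e) = eval_trm S f (snd e)"
    using assms(2) add_assoc add_comm add_idem mul_assoc distrib_left distrib_right
    by (auto simp: ai_axioms_def Let_def)
qed

lemma derives_mono: "derives E s t \<Longrightarrow> E \<subseteq> F \<Longrightarrow> derives F s t"
  by (induction rule: derives.induct) (auto intro: derives.intros)

section \<open>Identities after adjoining a zero\<close>

lemma eval_trm_adjoin_zero_Some:
  "(\<And>x. x \<in> vars s \<Longrightarrow> f x = Some (g x)) \<Longrightarrow>
    eval_trm (adjoin_zero S) f s = Some (eval_trm S g s)"
  by (induction s) (auto simp: adjoin_zero_def)

lemma eval_trm_adjoin_zero_None:
  "f x = None \<Longrightarrow> (\<And>w. w \<in> words s \<Longrightarrow> x \<in> set w) \<Longrightarrow> eval_trm (adjoin_zero S) f s = None"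
proof (induction s)
  case (Mul s t)
  \<comment> \<open>If a word of \<open>s\<close> and a word of \<open>t\<close> both missed
    \<open>x\<close>, so would their concatenation. Hence one factor has \<open>x\<close> in all its
    words and evaluates to the absorbing zero.\<close>
  have "(\<forall>v\<in>words s. x \<in> set v) \<or> (\<forall>w\<in>words t. x \<in> set w)"
    using Mul.prems(2) by fastforce
  then have "eval_trm (adjoin_zero S) f s = None \<or> eval_trm (adjoin_zero S) f t = None"
    using Mul.IH Mul.prems(1) by auto
  then show ?case
    by (auto simp: adjoin_zero_def split: option.splits)
qed (auto simp: adjoin_zero_def)

lemma satisfies_adjoin_zero:
  assumes S: "carrier S \<noteq> {}" and e: "satisfies S (s, t)"
    and C: "\<And>w. w \<in> words s \<union> words t \<Longrightarrow> set w = C"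
  shows "satisfies (adjoin_zero S) (s, t)"
  unfolding satisfies_def fst_conv snd_conv
proof (intro allI impI)
  fix f :: "nat \<Rightarrow> 'a option" assume f: "range f \<subseteq> carrier (adjoin_zero S)"
  have vars: "vars s = C" "vars t = C"
    using C words_nonempty unfolding vars_eq_Union_words by auto
  show "eval_trm (adjoin_zero S) f s = eval_trm (adjoin_zero S) f t"
  proof (cases "\<exists>x\<in>C. f x = None")
    case True
    then obtain x where "x \<in> C" "f x = None" by blast
    then show ?thesis
      using C eval_trm_adjoin_zero_None[of f x] by simp
  next
    case False
    obtain c where c: "c \<in> carrier S" using S by blast
    \<comment> \<open>The default \<open>c\<close> makes \<open>g\<close> a total assignment into
      \<open>S\<close>. It can only be used outside \<open>C\<close>, where no variable of
      \<open>s\<close> or \<open>t\<close> lies.\<close>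
    define g where "g x = (case f x of None \<Rightarrow> c | Some a \<Rightarrow> a)" for x
    have "\<forall>x. f x \<in> insert None (Some ` carrier S)"
      using f by (auto simp: adjoin_zero_def)
    then have "g x \<in> carrier S" for x
      using c by (cases "f x") (auto simp: g_def dest: spec[of _ x])
    then have "range g \<subseteq> carrier S" by auto
    then have "eval_trm S g s = eval_trm S g t"
      using e by (simp add: satisfies_def)
    moreover have "f x = Some (g x)" if "x \<in> C" for x
      using False that by (auto simp: g_def)
    then have "eval_trm (adjoin_zero S) f s = Some (eval_trm S g s)"
      "eval_trm (adjoin_zero S) f t = Some (eval_trm S g t)"
      using vars by (auto intro: eval_trm_adjoin_zero_Some)
    ultimately show ?thesis by simp
  qed
qed

section \<open>Transfer of identities between carrier types\<close>

lemma satisfies_of_variety_gen: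
  fixes A :: "'a bimagma"
  assumes inf: "infinite (UNIV :: 'u set)"
    and fin: "finite (carrier A)" and A: "subsemiring (carrier A) A"
    and e: "e \<in> identities (variety_gen {A} :: 'u bimagma set)"
  shows "satisfies A e"
proof -
  \<comment> \<open>Classes over \<open>'u\<close> do not contain \<open>A\<close> itself, which
    lives on another type. As \<open>'u\<close> is infinite and \<open>A\<close> finite, a copy
    \<open>T\<close> of \<open>A\<close> fits into \<open>'u\<close>.\<close>
  obtain \<phi> :: "'a \<Rightarrow> 'u" where \<phi>: "inj_on \<phi> (carrier A)"
  proof -
    obtain D :: "'u set" where "finite D" "card D = card (carrier A)"
      using infinite_arbitrarily_large[OF inf] by blast
    then show ?thesis
      using fin that finite_same_card_bij[of "carrier A" D] by (auto simp: bij_betw_def)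
  qed
  define \<psi> where "\<psi> = the_inv_into (carrier A) \<phi>"
  have \<psi>\<phi>: "\<psi> (\<phi> a) = a" if "a \<in> carrier A" for a
    using \<phi> that by (simp add: \<psi>_def the_inv_into_f_f)
  define T :: "'u bimagma" where
    "T = \<lparr>carrier = \<phi> ` carrier A,
          badd = (\<lambda>a b. \<phi> (\<psi> a \<boxplus>\<^bsub>A\<^esub> \<psi> b)), bmul = (\<lambda>a b. \<phi> (\<psi> a \<boxdot>\<^bsub>A\<^esub> \<psi> b))\<rparr>"
  \<comment> \<open>A product with the single factor \<open>A\<close>, projected to its only
    coordinate and then mapped by \<open>\<phi>\<close>, shows that \<open>T\<close> lies in the
    generated variety. Any index would serve.\<close>
  define i :: "nat \<times> 'u" where "i = undefined"
  let ?P = "direct_product {i} (\<lambda>_. A)"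
  have proj: "(\<lambda>f. f i) ` carrier ?P = carrier A"
  proof (intro equalityI subsetI)
    fix a assume "a \<in> carrier A"
    then have "(\<lambda>j\<in>{i}. a) \<in> carrier ?P" "(\<lambda>j\<in>{i}. a) i = a"
      by (auto simp: direct_product_def)
    then show "a \<in> (\<lambda>f. f i) ` carrier ?P" by (metis imageI)
  qed (auto simp: direct_product_def)
  have "subsemiring (carrier ?P) ?P"
  proof -
    have "carrier ?P \<noteq> {}"
      using proj A by (auto simp: subsemiring_def)
    then show ?thesis
      using A by (auto simp: subsemiring_def direct_product_def)
  qed
  moreover have "hom_onto (\<lambda>f. \<phi> (f i)) (?P\<lparr>carrier := carrier ?P\<rparr>) T"
  proof -
    have "(\<lambda>f. \<phi> (f i)) ` carrier ?P = \<phi> ` carrier A"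
      unfolding proj[symmetric] by (simp add: image_image)
    moreover have "f i \<in> carrier A" if "f \<in> carrier ?P" for f
      using that by (auto simp: direct_product_def)
    ultimately show ?thesis
      by (simp add: hom_onto_def T_def \<psi>\<phi>) (simp add: direct_product_def)
  qed
  ultimately have "T \<in> variety_gen {A}"
    unfolding variety_gen_def mem_Collect_eq
    by (intro exI[of _ "{i}"] exI[of _ "\<lambda>_. A"] exI[of _ "carrier ?P"]
        exI[of _ "\<lambda>f. \<phi> (f i)"]) simp
  with e have T: "satisfies T e"
    by (simp add: identities_def)
  have sT: "subsemiring (carrier T) T"
    using A by (auto simp: subsemiring_def T_def \<psi>\<phi>)
  \<comment> \<open>The inverse of the copying map carries the identity from \<open>T\<close> back
    to \<open>A\<close>.\<close>
  have "hom_onto \<psi> T A"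
    using A by (auto simp: hom_onto_def T_def subsemiring_def \<psi>\<phi> image_image)
  from satisfies_hom_image[OF sT this T] show ?thesis .
qed

lemma subsemiring_power_semiring:
  assumes "group H"
  shows "subsemiring (carrier (power_semiring H)) (power_semiring H)"
proof -
  interpret group H by fact
  let ?P = "power_semiring H"
  have "carrier H \<in> carrier ?P"
    using one_closed by (auto simp: power_semiring_def)
  moreover have "A \<boxplus>\<^bsub>?P\<^esub> B \<in> carrier ?P \<and> A \<boxdot>\<^bsub>?P\<^esub> B \<in> carrier ?P"
    if "A \<in> carrier ?P" "B \<in> carrier ?P" for A B
  proof -
    from that have AB: "A \<subseteq> carrier H" "B \<subseteq> carrier H" "A \<noteq> {}" "B \<noteq> {}"
      by (auto simp: power_semiring_def)
    have "A <#>\<^bsub>H\<^esub> B \<noteq> {}"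
      using AB(3,4) by (auto simp: set_mult_def)
    then show ?thesis
      using AB set_mult_closed[OF AB(1,2)] by (simp add: power_semiring_def)
  qed
  ultimately show ?thesis
    unfolding subsemiring_def by blast
qed

section \<open>Identities in boundedly many variables\<close>

lemma satisfies_if_generated_subsemirings:
  assumes S: "subsemiring (carrier S) S" and k: "card (identity_vars e) \<le> k"
    and gen: "\<And>X. X \<noteq> {} \<Longrightarrow> X \<subseteq> carrier S \<Longrightarrow> card X \<le> k \<Longrightarrow>
      satisfies (generated_subsemiring S X) e"
  shows "satisfies S e"
  unfolding satisfies_def
proof (intro allI impI)
  fix f :: "nat \<Rightarrow> 'a" assume f: "range f \<subseteq> carrier S"
  have fin: "finite (identity_vars e)"
    by (simp add: identity_vars_def finite_vars)
  obtain x where x: "x \<in> identity_vars e"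
    using vars_nonempty by (auto simp: identity_vars_def)
  define X where "X = f ` identity_vars e"
  \<comment> \<open>Variables foreign to \<open>e\<close> receive a value already in
    \<open>X\<close>, so the whole range of \<open>g\<close> lies in a subsemiring with at most
    \<open>k\<close> generators. Neither side of \<open>e\<close> notices the change.\<close>
  define g where "g y = (if y \<in> identity_vars e then f y else f x)" for y
  have "card X \<le> k"
    using card_image_le[OF fin, of f] k by (simp add: X_def)
  then have sat: "satisfies (generated_subsemiring S X) e"
    using f x by (intro gen) (auto simp: X_def)
  have "range g \<subseteq> X"
    using x by (auto simp: g_def X_def)
  then have "range g \<subseteq> carrier (generated_subsemiring S X)"
    by (auto simp: generated_subsemiring_def)
  with sat have "eval_trm S g (fst e) = eval_trm S g (snd e)"
    by (simp add: satisfies_def generated_subsemiring_def)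
  moreover have "eval_trm S g (fst e) = eval_trm S f (fst e)"
    "eval_trm S g (snd e) = eval_trm S f (snd e)"
    by (rule eval_trm_cong, simp add: g_def identity_vars_def)+
  ultimately show "eval_trm S f (fst e) = eval_trm S f (snd e)" by simp
qed

text \<open>A finite basis uses boundedly many variables per identity, so for large \<open>k\<close>
  it lies among the identities in at most \<open>k\<close> variables, which then form a basis
  too.\<close>

lemma not_finitely_based_if_infinite_axiomatic_rank:
  assumes "infinite_axiomatic_rank V"
  shows "\<not> finitely_based V"
proof
  assume "finitely_based V"
  then obtain E where E: "finite E" "basis_of E V"
    by (auto simp: finitely_based_def)
  \<comment> \<open>The sum bounds every single cardinality, and \<open>Suc\<close> secures
    \<open>k \<ge> 1\<close> even for empty \<open>E\<close>.\<close>
  define k where "k = Suc (\<Sum>e\<in>E. card (identity_vars e))"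
  let ?F = "{e \<in> identities V. card (identity_vars e) \<le> k}"
  have "card (identity_vars e) \<le> k" if "e \<in> E" for e
    using member_le_sum[OF that, of "\<lambda>e. card (identity_vars e)"] E(1) by (simp add: k_def)
  then have "ai_axioms \<union> E \<subseteq> ai_axioms \<union> ?F"
    using E(2) by (auto simp: basis_of_def)
  then have "basis_of ?F V"
    using E(2) derives_mono unfolding basis_of_def by blast
  moreover have "k \<ge> 1" by (simp add: k_def)
  ultimately show False
    using assms by (auto simp: infinite_axiomatic_rank_def)
qed

section \<open>Infinite axiomatic rank of the varieties between \<open>U\<close> and its zero
  extension\<close>

theorem corollary7p4:
  fixes H :: "'h monoid" and G :: "nat \<Rightarrow> 'g monoid" and t :: nat
    and Q :: "nat \<Rightarrow> 'q bimagma" and \<sigma> :: "nat \<Rightarrow> trm \<times> trm"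
    and U V :: "'u bimagma set"
  assumes "infinite (UNIV :: 'u set)"
    and "group H" and "finite (carrier H)" and "order H \<ge> 3"
    and "t \<ge> 1" and "\<forall>i\<in>{1..t}. group (G i) \<and> finite (carrier (G i))"
    and "\<forall>k\<ge>1. separating_pair k H t G (Q k) (\<sigma> k)"
    and "ai_variety U"
    and "variety_gen {power_semiring H} \<subseteq> U" and "U \<subseteq> class_W \<sigma>"
    and "ai_variety V" and "U \<subseteq> V" and "V \<subseteq> variety_zero U"
  shows "infinite_axiomatic_rank V \<and> \<not> finitely_based V"
proof -
  have "infinite_axiomatic_rank V"
    unfolding infinite_axiomatic_rank_def
  proof (intro allI impI notI)
    fix k :: nat
    assume k: "k \<ge> 1" and basis: "basis_of {e \<in> identities V. card (identity_vars e) \<le> k} V"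
    let ?e = "(snd (\<sigma> k), Add (snd (\<sigma> k)) (fst (\<sigma> k)))"
    have sp: "separating_pair k H t G (Q k) (\<sigma> k)"
      using assms(7) k by blast
    then have Q: "ai_semiring (Q k)"
      by (simp add: separating_pair_def)
    obtain C where C: "\<And>w. w \<in> words (fst (\<sigma> k)) \<union> words (snd (\<sigma> k)) \<Longrightarrow> set w = C"
      using sp unfolding separating_pair_def by blast
    have "satisfies (adjoin_zero S) ?e" if "S \<in> U" for S
    proof (rule satisfies_adjoin_zero)
      have "S \<in> class_W \<sigma>" using that assms(10) by blast
      then show "carrier S \<noteq> {}" "satisfies S ?e"
        using k by (auto simp: class_W_def satisfies_ineq_def ai_semiring.nonempty)
    next
      fix w assume "w \<in> words (snd (\<sigma> k)) \<union> words (Add (snd (\<sigma> k)) (fst (\<sigma> k)))"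
      then show "set w = C" using C[of w] by auto
    qed
    then have "satisfies S ?e" if "S \<in> V" for S
      using that assms(13) satisfies_variety_gen[of S "adjoin_zero ` U" ?e]
      by (auto simp: variety_zero_def)
    then have "?e \<in> identities V"
      by (simp add: identities_def)
    \<comment> \<open>The number of variables of \<open>\<sigma> k\<close> itself is not bounded
      here; the assumed basis derives every identity of \<open>V\<close>.\<close>
    then have derives: "derives (ai_axioms \<union> {e \<in> identities V. card (identity_vars e) \<le> k})
        (snd (\<sigma> k)) (Add (snd (\<sigma> k)) (fst (\<sigma> k)))"
      using basis unfolding basis_of_def by blast
    have "satisfies (Q k) e" if e: "e \<in> identities V" "card (identity_vars e) \<le> k" for e
    proof (rule satisfies_if_generated_subsemirings[OF subsemiring_carrier[OF Q] e(2)])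
      have "finite (carrier (power_semiring H))"
        using assms(3) by (simp add: power_semiring_def)
      \<comment> \<open>The copies over \<open>'u\<close> of algebras in the variety of the power
        semiring belong to \<open>U\<close>, hence to \<open>V\<close>. Finiteness of
        \<open>H\<close> then brings \<open>e\<close> back to the power semiring itself.\<close>
      moreover have "e \<in> identities (variety_gen {power_semiring H} :: 'u bimagma set)"
        using e(1) assms(9,12) by (auto simp: identities_def)
      ultimately have H: "satisfies (power_semiring H) e"
        using satisfies_of_variety_gen[OF assms(1)] subsemiring_power_semiring[OF assms(2)]
        by blast
      fix X assume "X \<noteq> {}" "X \<subseteq> carrier (Q k)" "card X \<le> k"
      then have "generated_subsemiring (Q k) X \<in> variety_gen {power_semiring H}"
        using sp unfolding separating_pair_def by blast
      then show "satisfies (generated_subsemiring (Q k) X) e"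
        by (rule satisfies_variety_gen) (simp add: H)
    qed
    \<comment> \<open>Both the ai-semiring axioms and the bounded identities hold in
      \<open>Q k\<close>, so soundness of derivations forces \<open>\<sigma> k\<close> there,
      against the choice of the pair.\<close>
    then have "satisfies (Q k) ?e"
      using satisfies_derives[OF subsemiring_carrier[OF Q] _ derives] satisfies_ai_axioms[OF Q]
      by blast
    then show False
      using sp by (simp add: separating_pair_def satisfies_ineq_def)
  qed
  then show ?thesis
    using not_finitely_based_if_infinite_axiomatic_rank by blast
qed

end
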